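(* If $\mathfrak s\leq\mathfrak{ie}$, then there exists an almost disjoint family of cardinality $\mathfrak s$ that is not fin-intersecting.
   Context: An almost disjoint family on a countably infinite set $N$ is an infinite set $\mathcal A$ of infinite subsets of $N$ such that $a\cap b$ is finite for all distinct $a,b\in\mathcal A$; the choice of $N$ is immaterial and one may take $N=\omega$. A fin sequence (on $N$) is a function $C:\omega\to[N]^{<\omega}\setminus\{\emptyset\}$ with $C(n)\cap C(m)=\emptyset$ whenever $n\neq m$. A collection of sets is centered if every finite nonempty subcollection has infinite intersection. An almost disjoint family $\mathcal A$ is fin-intersecting if for every fin sequence $C$ there exists an infinite $I\subseteq\omega$ such that $\{\{n\in I: a\cap C(n)\neq\emptyset\}: a\in\mathcal A\}\setminus[I]^{<\omega}$ is centered, where $[I]^{<\omega}$ is the set of finite subsets of $I$. $\mathfrak s$ is the least cardinality of a collection $\mathcal S$ of infinite subsets of $\omega$ such that for every infinite $X\subseteq\omega$ there is $S\in\mathcal S$ with both $X\cap S$ and $X\setminus S$ infinite. Let $\triangle=\{(n,m)\in\omega\times\omega: m\leq n\}$. $\mathfrak{ie}$ is the least cardinality of a collection $\mathcal F$ of infinite partial functions from $\omega$ to $\omega$ contained (as graphs) in $\triangle$ such that no total function from $\omega$ to $\omega$ contained in $\triangle$ is almost disjoint from (i.e. has finite intersection, as a set of pairs, with) every element of $\mathcal F$. *)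

theory Defs
  imports "HOL-Library.Countable_Set" "HOL-Library.Disjoint_Sets"
begin

unbundle cardinal_syntax

definition almost_disjoint_family :: "'a set \<Rightarrow> 'a set set \<Rightarrow> bool" where
  "almost_disjoint_family N \<A> \<longleftrightarrow>
     countable N \<and> infinite N \<and> infinite \<A> \<and>
     (\<forall>a\<in>\<A>. a \<subseteq> N \<and> infinite a) \<and>
     (\<forall>a\<in>\<A>. \<forall>b\<in>\<A>. a \<noteq> b \<longrightarrow> finite (a \<inter> b))"

definition fin_sequence :: "'a set \<Rightarrow> (nat \<Rightarrow> 'a set) \<Rightarrow> bool" where
  "fin_sequence N C \<longleftrightarrow> (\<forall>n. C n \<in> Fpow N - {{}}) \<and> disjoint_family C"

definition centered :: "'a set set \<Rightarrow> bool" where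
  "centered \<X> \<longleftrightarrow> (\<forall>\<F>\<subseteq>\<X>. finite \<F> \<and> \<F> \<noteq> {} \<longrightarrow> infinite (\<Inter>\<F>))"

text \<open>\<open>Fpow I\<close> is the set of finite subsets of \<open>I\<close>.\<close>

definition fin_intersecting :: "'a set \<Rightarrow> 'a set set \<Rightarrow> bool" where
  "fin_intersecting N \<A> \<longleftrightarrow>
     (\<forall>C. fin_sequence N C \<longrightarrow>
        (\<exists>I::nat set. infinite I \<and>
           centered ((\<lambda>a. {n\<in>I. a \<inter> C n \<noteq> {}}) ` \<A> - Fpow I)))"

text \<open>Cardinals are represented by cardinal orders, compared with \<open>\<le>o\<close> and \<open>=o\<close>.
  For a nonempty class \<open>\<P>\<close> of sets the choice below is of a member of least cardinality,
  which exists by well-foundedness (lemma \<open>least_card_witness\<close>).\<close>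

definition least_card :: "'a set set \<Rightarrow> 'a rel" where
  "least_card \<P> = |SOME A. A \<in> \<P> \<and> (\<forall>B\<in>\<P>. |A| \<le>o |B| )|"

lemma least_card_witness:
  assumes "\<P> \<noteq> {}"
  obtains A where "A \<in> \<P>" "least_card \<P> = |A|" "\<And>B. B \<in> \<P> \<Longrightarrow> |A| \<le>o |B|"
proof -
  have "card_of ` \<P> \<noteq> {}" "\<forall>r\<in>card_of ` \<P>. Well_order r"
    using assms by (simp_all add: card_of_Well_order)
  then obtain r where r: "r \<in> card_of ` \<P>" "\<forall>r'\<in>card_of ` \<P>. r \<le>o r'"
    using exists_minim_Well_order[of "card_of ` \<P>"] by metis
  from r(1) obtain A where "A \<in> \<P>" "r = |A|"
    by (rule imageE)
  with r(2) have "A \<in> \<P> \<and> (\<forall>B\<in>\<P>. |A| \<le>o |B| )"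
    by simp
  then have "(SOME A. A \<in> \<P> \<and> (\<forall>B\<in>\<P>. |A| \<le>o |B| )) \<in> \<P> \<and>
      (\<forall>B\<in>\<P>. |SOME A. A \<in> \<P> \<and> (\<forall>B\<in>\<P>. |A| \<le>o |B| )| \<le>o |B| )"
    by (rule someI)
  then show ?thesis
    by (intro that[OF _ least_card_def]) simp_all
qed

definition splitting_family :: "nat set set \<Rightarrow> bool" where
  "splitting_family \<S> \<longleftrightarrow>
     (\<forall>S\<in>\<S>. infinite S) \<and>
     (\<forall>X. infinite X \<longrightarrow> (\<exists>S\<in>\<S>. infinite (X \<inter> S) \<and> infinite (X - S)))"

definition splitting_number :: "nat set rel" where
  "splitting_number = least_card {\<S>. splitting_family \<S>}"

definition lower_triangle :: "(nat \<times> nat) set" where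
  "lower_triangle = {(n, m). m \<le> n}"

definition ie_family :: "(nat \<rightharpoonup> nat) set \<Rightarrow> bool" where
  "ie_family \<F> \<longleftrightarrow>
     (\<forall>f\<in>\<F>. infinite (Map.graph f) \<and> Map.graph f \<subseteq> lower_triangle) \<and>
     \<not> (\<exists>g :: nat \<Rightarrow> nat. Map.graph (Some \<circ> g) \<subseteq> lower_triangle \<and>
          (\<forall>f\<in>\<F>. finite (Map.graph f \<inter> Map.graph (Some \<circ> g))))"

definition ie_number :: "(nat \<rightharpoonup> nat) rel" where
  "ie_number = least_card {\<F>. ie_family \<F>}"

lemma splitting_family_ex: "{\<S>. splitting_family \<S>} \<noteq> {}"
proof -
  have "\<exists>S. infinite S \<and> infinite (X \<inter> S) \<and> infinite (X - S)" if X: "infinite X" for X :: "nat set"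
  proof -
    obtain A B where AB: "A \<subseteq> X" "B \<subseteq> X" "infinite A" "infinite B" "A \<inter> B = {}"
      using infinite_split[OF X] by blast
    then have "X \<inter> A = A" "B \<subseteq> X - A"
      by blast+
    with AB(3,4) have "infinite A" "infinite (X \<inter> A)" "infinite (X - A)"
      by (simp_all add: infinite_super)
    then show ?thesis by blast
  qed
  then have "splitting_family {S. infinite S}"
    unfolding splitting_family_def by blast
  then show ?thesis by blast
qed

lemma ie_family_ex: "{\<F>. ie_family \<F>} \<noteq> {}"
proof -
  have "infinite (Map.graph (Some \<circ> g))" for g :: "nat \<Rightarrow> nat"
  proof -
    have "fst ` Map.graph (Some \<circ> g) = UNIV"
      by (force simp: Map.graph_def image_iff)
    then show ?thesis using finite_imageI[of _ fst] infinite_UNIV_nat by metis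
  qed
  note inf = this
  have "ie_family {f. infinite (Map.graph f) \<and> Map.graph f \<subseteq> lower_triangle}" (is "ie_family ?F")
    unfolding ie_family_def
  proof (intro conjI notI)
    assume "\<exists>g :: nat \<Rightarrow> nat. Map.graph (Some \<circ> g) \<subseteq> lower_triangle \<and>
      (\<forall>f\<in>?F. finite (Map.graph f \<inter> Map.graph (Some \<circ> g)))"
    then obtain g :: "nat \<Rightarrow> nat" where g: "Map.graph (Some \<circ> g) \<subseteq> lower_triangle"
      "\<forall>f\<in>?F. finite (Map.graph f \<inter> Map.graph (Some \<circ> g))" by (elim exE conjE)
    have "Some \<circ> g \<in> ?F"
      using inf[of g] g(1) by (intro CollectI conjI)
    with g(2) have "finite (Map.graph (Some \<circ> g) \<inter> Map.graph (Some \<circ> g))"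
      by (rule bspec)
    then show False
      using inf[of g] by (simp only: Int_absorb)
  qed simp
  then show ?thesis by blast
qed

end

theory Submission imports Defs begin

text \<open>The obstruction lives on the triangle of pairs \<open>(n, m)\<close> with \<open>m \<le> n\<close>, whose columns form a
  fin sequence. An infinite set \<open>I\<close> of columns is witnessed not to work as soon as two members of
  the family trace \<open>I \<inter> S\<close> and \<open>I - S\<close> on \<open>I\<close> for some \<open>S\<close> that splits \<open>I\<close>: both traces are
  infinite, yet disjoint. Restricting a function \<open>g\<close> below the diagonal to \<open>S\<close> and to the
  complement of \<open>S\<close> produces such a pair of members, so it suffices to do this for every \<open>S\<close> in
  a splitting family of least cardinality, with a different function \<open>g\<^sub>S\<close> for each \<open>S\<close>.

  The resulting family is almost disjoint once the functions \<open>g\<^sub>S\<close> are pairwise eventually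
  different. They are chosen by transfinite recursion along the least cardinality
  (\<open>eventually_different_below_diagonal\<close>): fewer than \<open>\<ss>\<close> functions have been chosen at any
  stage, hence, as \<open>\<ss> \<le> \<ii>\<ee>\<close>, fewer than \<open>\<ii>\<ee>\<close>, so some total function below the diagonal
  is almost disjoint from all of them (\<open>ie_number_escape\<close>). That the two restrictions for each
  \<open>S\<close> do not raise the cardinality rests on splitting families being infinite
  (\<open>splitting_family_infinite\<close>).\<close>

lemma finite_graph_Int_total:
  "finite (Map.graph (Some \<circ> f) \<inter> Map.graph (Some \<circ> g)) \<longleftrightarrow> finite {n. f n = g n}"
proof -
  have "Map.graph (Some \<circ> f) \<inter> Map.graph (Some \<circ> g) = (\<lambda>n. (n, f n)) ` {n. f n = g n}"
    by (auto simp: Map.graph_def)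
  then show ?thesis
    by (simp add: finite_image_iff inj_on_def)
qed

lemma graph_total_below_diagonal:
  "Map.graph (Some \<circ> g) \<subseteq> lower_triangle \<longleftrightarrow> (\<forall>n. g n \<le> n)"
  by (auto simp: Map.graph_def lower_triangle_def)

lemma ie_number_escape:
  fixes G :: "(nat \<Rightarrow> nat) set"
  assumes "|G| <o ie_number" and "\<forall>g\<in>G. \<forall>n. g n \<le> n"
  shows "\<exists>h. (\<forall>n. h n \<le> n) \<and> (\<forall>g\<in>G. finite {n. g n = h n})"
proof -
  let ?F = "(\<lambda>g. Some \<circ> g) ` G"
  obtain B where B: "ie_number = |B|" "\<And>F. ie_family F \<Longrightarrow> |B| \<le>o |F|"
    by (rule least_card_witness[OF ie_family_ex, folded ie_number_def]) simp
  have "|?F| <o ie_number"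
    using card_of_image assms(1) by (rule ordLeq_ordLess_trans)
  then have "\<not> ie_family ?F"
    using B not_ordLess_ordLeq by metis
  moreover have "infinite (Map.graph (Some \<circ> g))" for g :: "nat \<Rightarrow> nat"
    using finite_graph_Int_total[of g g] by simp
  ultimately obtain h :: "nat \<Rightarrow> nat" where
    "Map.graph (Some \<circ> h) \<subseteq> lower_triangle"
    "\<forall>f\<in>?F. finite (Map.graph f \<inter> Map.graph (Some \<circ> h))"
    using assms(2) unfolding ie_family_def by (auto simp: graph_total_below_diagonal)
  then show ?thesis
    by (intro exI[of _ h]) (auto simp: graph_total_below_diagonal finite_graph_Int_total)
qed

text \<open>Along a well-order of \<open>A\<close> of minimal order type, every proper initial segment is smaller than
  \<open>A\<close>, so the functions indexed by it are too few to catch every function below the diagonal.\<close>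

lemma eventually_different_below_diagonal:
  fixes A :: "'a set"
  assumes "|A| \<le>o ie_number"
  shows "\<exists>G :: 'a \<Rightarrow> nat \<Rightarrow> nat. (\<forall>x\<in>A. \<forall>n. G x n \<le> n) \<and>
           pairwise (\<lambda>x y. finite {n. G x n = G y n}) A"
proof -
  let ?R = "|A| - Id"
  define P where "P f x h \<longleftrightarrow> x \<in> A \<longrightarrow>
      (\<forall>n. h n \<le> n) \<and> (\<forall>y. (y, x) \<in> ?R \<longrightarrow> finite {n. f y n = h n})"
    for f :: "'a \<Rightarrow> nat \<Rightarrow> nat" and x and h :: "nat \<Rightarrow> nat"
  have wo: "well_order_on A |A|" and field: "Field |A| = A"
    by (rule card_of_well_order_on, rule Field_card_of)
  have "wf ?R"
    using wo unfolding well_order_on_def by blast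
  then have "\<exists>f. \<forall>x. P f x (f x)"
  proof (rule dependent_wf_choice)
    show "P f x h = P g x h" if "\<And>y. (y, x) \<in> ?R \<Longrightarrow> f y = g y" for f g x h
      using that unfolding P_def by simp
    show "\<exists>h. P f x h" if IH: "\<And>y. (y, x) \<in> ?R \<Longrightarrow> P f y (f y)" for f x
    proof (cases "x \<in> A")
      case True
      let ?U = "underS |A| x"
      have "|f ` ?U| \<le>o |?U|"
        by (rule card_of_image)
      also have "|?U| <o |A|"
        using True field by (intro card_of_underS card_of_Card_order) simp
      finally have "|f ` ?U| <o ie_number"
        using assms by (rule ordLess_ordLeq_trans)
      moreover have "\<forall>g\<in>f ` ?U. \<forall>n. g n \<le> n"
        using IH field by (auto simp: P_def underS_def intro: FieldI1)
      ultimately obtain h where "\<forall>n. h n \<le> n" "\<forall>g\<in>f ` ?U. finite {n. g n = h n}"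
        using ie_number_escape by blast
      then have "P f x h"
        by (auto simp: P_def underS_def)
      then show ?thesis
        by blast
    qed (simp add: P_def)
  qed
  then obtain G where G: "\<And>x. P G x (G x)"
    by blast
  have "finite {n. G x n = G y n}" if "x \<in> A" "y \<in> A" "x \<noteq> y" for x y
  proof -
    have "(x, y) \<in> ?R \<or> (y, x) \<in> ?R"
      using wo that field by (auto simp: order_on_defs total_on_def)
    moreover have "{n. G x n = G y n} = {n. G y n = G x n}"
      by auto
    ultimately show ?thesis
      using G[of x] G[of y] that by (auto simp: P_def)
  qed
  moreover have "G x n \<le> n" if "x \<in> A" for x n
    using G[of x] that by (simp add: P_def)
  ultimately show ?thesis
    unfolding pairwise_def by blast
qed

text \<open>Each further set \<open>S\<close> is handled by shrinking \<open>X\<close> to \<open>X \<inter> S\<close> if that is still infinite;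
  shrinking preserves not being split by the earlier sets.\<close>

lemma finite_unsplit:
  fixes \<S> :: "nat set set"
  assumes "finite \<S>"
  shows "\<exists>X. infinite X \<and> (\<forall>S\<in>\<S>. finite (X \<inter> S) \<or> finite (X - S))"
  using assms
proof induction
  case empty
  show ?case
    using infinite_UNIV_nat by auto
next
  case (insert S \<S>)
  then obtain X where X: "infinite X" "\<forall>S\<in>\<S>. finite (X \<inter> S) \<or> finite (X - S)"
    by blast
  define Y where "Y = (if finite (X \<inter> S) then X else X \<inter> S)"
  have "Y \<subseteq> X" "infinite Y" "finite (Y \<inter> S) \<or> finite (Y - S)"
    using X(1) by (auto simp: Y_def Int_Diff)
  moreover have "finite (Y \<inter> T) \<or> finite (Y - T)" if "T \<in> \<S>" for T
  proof -
    have "Y \<inter> T \<subseteq> X \<inter> T" "Y - T \<subseteq> X - T"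
      using \<open>Y \<subseteq> X\<close> by blast+
    then show ?thesis
      using X(2) that finite_subset by blast
  qed
  ultimately show ?case
    by blast
qed

lemma splitting_family_infinite: "splitting_family \<S> \<Longrightarrow> infinite \<S>"
  using finite_unsplit unfolding splitting_family_def by metis

text \<open>Cofinite members split nothing, so they can be dropped; then the complement of every remaining
  member is infinite and can serve as the domain of an infinite partial function.\<close>

lemma splitting_number_witness:
  obtains \<S> where "splitting_family \<S>" "|\<S>| =o splitting_number" "\<And>S. S \<in> \<S> \<Longrightarrow> infinite (- S)"
proof -
  obtain \<T> where \<T>: "splitting_family \<T>" "splitting_number = |\<T>|"
    "\<And>\<S>. splitting_family \<S> \<Longrightarrow> |\<T>| \<le>o |\<S>|"
    by (rule least_card_witness[OF splitting_family_ex, folded splitting_number_def]) simp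
  let ?\<S> = "{S\<in>\<T>. infinite (- S)}"
  have "infinite (- S)" if "infinite (X - S)" for X S :: "nat set"
    using that by (rule infinite_super[rotated]) blast
  then have \<S>: "splitting_family ?\<S>"
    using \<T>(1) unfolding splitting_family_def by blast
  moreover have "|?\<S>| \<le>o |\<T>|"
    by (rule card_of_mono1) blast
  ultimately have "|?\<S>| =o splitting_number"
    using \<T>(2,3) by (simp add: ordIso_iff_ordLeq)
  with \<S> show ?thesis
    by (rule that) simp
qed

text \<open>The triangle is transported to \<open>\<nat>\<close> by the pairing function \<^const>\<open>prod_encode\<close>.\<close>

definition coded_graph :: "(nat \<Rightarrow> nat) \<Rightarrow> nat set \<Rightarrow> nat set" where
  "coded_graph g D = (\<lambda>n. prod_encode (n, g n)) ` D"

definition coded_column :: "nat \<Rightarrow> nat set" where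
  "coded_column n = (\<lambda>m. prod_encode (n, m)) ` {..n}"

lemma infinite_coded_graph: "infinite D \<Longrightarrow> infinite (coded_graph g D)"
  by (simp add: coded_graph_def finite_image_iff inj_on_def)

lemma coded_graph_Int:
  "coded_graph g D \<inter> coded_graph h E = coded_graph g {n \<in> D \<inter> E. g n = h n}"
  by (auto simp: coded_graph_def image_iff)

lemma coded_graph_meets_column:
  assumes "\<And>n. g n \<le> n"
  shows "{n\<in>I. coded_graph g D \<inter> coded_column n \<noteq> {}} = I \<inter> D"
  using assms by (auto simp: coded_graph_def coded_column_def)

lemma fin_sequence_coded_column: "fin_sequence UNIV coded_column"
  by (auto simp: fin_sequence_def coded_column_def Fpow_def disjoint_family_on_def)

text \<open>Given \<open>I\<close>, take the graph indexed by a member \<open>S\<close> that splits \<open>I\<close>. A graph meets exactly the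
  columns over its domain, so the two halves have the traces \<open>I \<inter> S\<close> and \<open>I - S\<close>: neither is
  discarded as finite, and together they violate centeredness.\<close>

lemma split_graphs_not_fin_intersecting:
  assumes "splitting_family \<S>" and below: "\<forall>S\<in>\<S>. \<forall>n. G S n \<le> n"
    and halves: "\<And>S. S \<in> \<S> \<Longrightarrow> coded_graph (G S) S \<in> \<A> \<and> coded_graph (G S) (- S) \<in> \<A>"
  shows "\<not> fin_intersecting UNIV \<A>"
proof
  assume "fin_intersecting UNIV \<A>"
  then obtain I where I: "infinite I"
    "centered ((\<lambda>a. {n\<in>I. a \<inter> coded_column n \<noteq> {}}) ` \<A> - Fpow I)" (is "centered ?X")
    using fin_sequence_coded_column unfolding fin_intersecting_def by blast
  obtain S where S: "S \<in> \<S>" "infinite (I \<inter> S)" "infinite (I - S)"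
    using assms(1) I(1) unfolding splitting_family_def by blast
  have trace: "I \<inter> D \<in> ?X" if "coded_graph (G S) D \<in> \<A>" "infinite (I \<inter> D)" for D
    using that coded_graph_meets_column[of "G S" I D] below S(1) by (auto simp: Fpow_def)
  have "{I \<inter> S, I \<inter> - S} \<subseteq> ?X"
    using trace[of S] trace[of "- S"] halves[OF S(1)] S(2,3) by (simp add: Diff_eq)
  then have "infinite (\<Inter>{I \<inter> S, I \<inter> - S})"
    using I(2) unfolding centered_def by (elim allE[of _ "{I \<inter> S, I \<inter> - S}"]) simp
  moreover have "\<Inter>{I \<inter> S, I \<inter> - S} = {}"
    by auto
  ultimately show False
    by simp
qed

theorem proposition27:
  assumes "splitting_number \<le>o ie_number"
  shows "\<exists>\<A> :: nat set set. almost_disjoint_family UNIV \<A> \<and> |\<A>| =o splitting_number \<and>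
           \<not> fin_intersecting UNIV \<A>"
proof -
  obtain \<S> where \<S>: "splitting_family \<S>" "|\<S>| =o splitting_number"
    "\<And>S. S \<in> \<S> \<Longrightarrow> infinite (- S)"
    by (rule splitting_number_witness) simp
  have inf\<S>: "infinite \<S>"
    by (rule splitting_family_infinite[OF \<S>(1)])
  obtain G :: "nat set \<Rightarrow> nat \<Rightarrow> nat" where below: "\<forall>S\<in>\<S>. \<forall>n. G S n \<le> n"
    and diff: "pairwise (\<lambda>S T. finite {n. G S n = G T n}) \<S>"
    using eventually_different_below_diagonal[OF ordIso_ordLeq_trans[OF \<S>(2) assms]] by blast
  define a where "a S = coded_graph (G S) S" for S
  define b where "b S = coded_graph (G S) (- S)" for S
  define \<A> where "\<A> = a ` \<S> \<union> b ` \<S>"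
  \<comment> \<open>Graphs of eventually different functions stay almost disjoint whatever their domains.\<close>
  have finite_Int: "finite (coded_graph (G S) D \<inter> coded_graph (G T) E)"
    if "S \<in> \<S>" "T \<in> \<S>" "S \<noteq> T" for S T D E
    using pairwiseD[OF diff that] unfolding coded_graph_Int
    by (auto simp: coded_graph_def intro!: finite_imageI intro: rev_finite_subset)
  have inf_a: "infinite (a S)" and inf_b: "infinite (b S)" if "S \<in> \<S>" for S
    using that \<S>(1,3) by (simp_all add: a_def b_def infinite_coded_graph splitting_family_def)
  have halves: "a S \<inter> b S = {}" for S
    by (auto simp: a_def b_def coded_graph_def)
  have inj: "inj_on a \<S>"
  proof (rule inj_onI)
    fix S T assume *: "S \<in> \<S>" "T \<in> \<S>" "a S = a T"
    show "S = T"
    proof (rule ccontr)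
      assume "S \<noteq> T"
      then have "finite (a S \<inter> a T)"
        unfolding a_def by (rule finite_Int[OF *(1,2)])
      then show False
        using inf_a[OF *(1)] *(3) by simp
    qed
  qed
  have "|\<S>| \<le>o |\<A>|"
    using inj by (rule card_of_ordLeqI) (simp add: \<A>_def)
  moreover have "|\<A>| \<le>o |\<S>|"
    unfolding \<A>_def
    by (rule card_of_Un_ordLeq_infinite_Field)
      (simp_all add: inf\<S> Field_card_of card_of_image card_of_card_order_on)
  ultimately have card: "|\<A>| =o |\<S>|"
    by (simp add: ordIso_iff_ordLeq)
  have "infinite \<A>"
    using card_of_ordIso_finite[OF card] inf\<S> by simp
  moreover have "finite (c \<inter> d)" if cd: "c \<in> \<A>" "d \<in> \<A>" "c \<noteq> d" for c d
  proof -
    obtain S T where ST: "S \<in> \<S>" "c \<in> {a S, b S}" "T \<in> \<S>" "d \<in> {a T, b T}"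
      using cd(1,2) unfolding \<A>_def by blast
    show ?thesis
    proof (cases "S = T")
      case True
      then have "c \<inter> d = {}"
        using ST cd(3) halves[of S] by auto
      then show ?thesis by simp
    next
      case False
      then show ?thesis
        using ST finite_Int unfolding a_def b_def by blast
    qed
  qed
  ultimately have "almost_disjoint_family UNIV \<A>"
    using inf_a inf_b unfolding almost_disjoint_family_def by (auto simp: \<A>_def)
  moreover have "\<not> fin_intersecting UNIV \<A>"
    using \<S>(1) below by (rule split_graphs_not_fin_intersecting) (auto simp: \<A>_def a_def b_def)
  moreover have "|\<A>| =o splitting_number"
    using card \<S>(2) by (rule ordIso_transitive)
  ultimately show ?thesis
    by blast
qed

end
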